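(* For all $n\geq1$, \[ G_n(p,q,x)=\sum_{u\in U_n}pqx\,\frac{(px)^{\mathrm{ret}_1^-(u)}(qx)^{\mathrm{ret}_1^+(u)}}{(1-px)^{u(1)}(1-qx)^{n+1-u(1)}}=\frac{pqx\,U_n(px,qx)}{(1-qx)^{n+1}}. \]
   Context: For $n\ge1$, let $\mathcal{A}_n(m)$ be the set of maps $f:[n]\to\{1,\dots,m\}$ with $f(j)\le f(j+1)$ for odd $j\in[n-1]$ and $f(j)\ge f(j+1)$ for even $j\in[n-1]$; $\Omega_n(p,q;m)=\sum_{f\in\mathcal{A}_n(m)}p^{f(1)}q^{m+1-f(1)}$ and $G_n(p,q,x)=\sum_{m\ge1}\Omega_n(p,q;m)x^m$. $U_n$ is the set of $u\in S_n$ with $u(1)<u(2)>u(3)<\cdots$. For $u\in S_n$, $\mathrm{Ret}_1(u)=\{i\in[n-1]:u^{-1}(i)>u^{-1}(i+1)+1\}$, $\mathrm{ret}_1^-(u)=|\mathrm{Ret}_1(u)\cap\{1,\dots,u(1)\}|$, $\mathrm{ret}_1^+(u)=|\mathrm{Ret}_1(u)\cap\{u(1)+1,\dots,n-1\}|$. $U_n(s,t)=\sum_{u\in U_n}s^{\mathrm{ret}_1^-(u)}t^{\mathrm{ret}_1^+(u)}\left(\frac{1-t}{1-s}\right)^{u(1)}$. *)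

theory Defs
  imports
    "HOL-Library.FuncSet"
    "HOL-Combinatorics.Permutations"
    "HOL-Computational_Algebra.Formal_Power_Series"
begin

definition alt_maps :: "nat \<Rightarrow> nat \<Rightarrow> (nat \<Rightarrow> nat) set" where
  "alt_maps n m = {f \<in> {1..n} \<rightarrow>\<^sub>E {1..m}.
     \<forall>j\<in>{1..n - 1}. (odd j \<longrightarrow> f j \<le> f (j + 1)) \<and> (even j \<longrightarrow> f j \<ge> f (j + 1))}"

definition Omega :: "nat \<Rightarrow> 'a::comm_semiring_1 \<Rightarrow> 'a \<Rightarrow> nat \<Rightarrow> 'a" where
  "Omega n p q m = (\<Sum>f\<in>alt_maps n m. p ^ f 1 * q ^ (m + 1 - f 1))"

text \<open>
  The generating function is a formal power series in \<open>x\<close>. The parameters \<open>p\<close> and \<open>q\<close> are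
  arbitrary elements of the coefficient ring; two independent indeterminates are the special case
  where that ring contains the polynomial ring in \<open>p\<close> and \<open>q\<close>.
\<close>

definition G :: "nat \<Rightarrow> 'a::comm_semiring_1 \<Rightarrow> 'a \<Rightarrow> 'a fps" where
  "G n p q = Abs_fps (\<lambda>m. if m \<ge> 1 then Omega n p q m else 0)"

definition alt_perms :: "nat \<Rightarrow> (nat \<Rightarrow> nat) set" where
  "alt_perms n = {u. u permutes {1..n} \<and>
     (\<forall>j\<in>{1..n - 1}. (odd j \<longrightarrow> u j < u (j + 1)) \<and> (even j \<longrightarrow> u j > u (j + 1)))}"

definition Ret1 :: "nat \<Rightarrow> (nat \<Rightarrow> nat) \<Rightarrow> nat set" where
  "Ret1 n u = {i \<in> {1..n - 1}. inv u i > inv u (i + 1) + 1}"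

definition ret1_minus :: "nat \<Rightarrow> (nat \<Rightarrow> nat) \<Rightarrow> nat" where
  "ret1_minus n u = card (Ret1 n u \<inter> {1..u 1})"

definition ret1_plus :: "nat \<Rightarrow> (nat \<Rightarrow> nat) \<Rightarrow> nat" where
  "ret1_plus n u = card (Ret1 n u \<inter> {u 1 + 1..n - 1})"

text \<open>
  The sort allows \<open>s\<close> and \<open>t\<close> to be elements of a field as well as formal power series over a
  field. In the latter case the quotient is the genuine one as soon as \<open>1 - s\<close> is a unit,
  for example if \<open>s\<close> has constant coefficient zero.
\<close>

definition U :: "nat \<Rightarrow> 'b::{comm_ring_1, inverse} \<Rightarrow> 'b \<Rightarrow> 'b" where
  "U n s t = (\<Sum>u\<in>alt_perms n.
     s ^ ret1_minus n u * t ^ ret1_plus n u * ((1 - t) / (1 - s)) ^ u 1)"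

end

theory Submission
  imports Defs
begin

text \<open>Relabelling the zigzag poset by exchanging \<open>j\<close> and \<open>j + 1\<close> for even \<open>j\<close> makes the labelling
  natural, and for \<open>u\<close> in \<open>alt_perms n\<close> the descents of the word obtained by relabelling \<open>inv u\<close>
  are exactly the elements of \<open>Ret1 n u\<close>. As in the fundamental lemma on P-partitions, sorting the
  positions by the value of \<open>f\<close>, with ties broken by the new label, splits the maps \<open>f\<close> into
  classes indexed by \<open>u\<close>: the class of \<open>u\<close> consists of the weakly increasing sequences
  \<open>a\<^sub>1 \<le> \<dots> \<le> a\<^sub>n\<close> that are strict at \<open>Ret1 n u\<close>. The gaps of such a sequence are independent; those
  before \<open>a (u 1) = f 1\<close> are weighted by \<open>p x\<close> and those after it by \<open>q x\<close>, which gives one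
  geometric series per gap.\<close>

section \<open>Chains with prescribed strict steps\<close>

text \<open>The values start at \<open>0\<close>, whereas those of \<open>alt_maps\<close> start at \<open>1\<close>.\<close>

definition strict_chains :: "nat \<Rightarrow> nat set \<Rightarrow> nat \<Rightarrow> (nat \<Rightarrow> nat) set" where
  "strict_chains n S M = {a \<in> {1..n} \<rightarrow>\<^sub>E {0..M}.
     \<forall>i\<in>{1..<n}. a i \<le> a (Suc i) \<and> (i \<in> S \<longrightarrow> a i < a (Suc i))}"

lemma finite_chains [simp]: "finite (strict_chains n S M)"
  by (rule finite_subset[of _ "{1..n} \<rightarrow>\<^sub>E {0..M}"]) (auto simp: strict_chains_def intro: finite_PiE)

lemma chains_0 [simp]: "strict_chains 0 S M = {\<lambda>_. undefined}"
  by (auto simp: strict_chains_def)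

lemma chains_le_last:
  assumes "a \<in> strict_chains n S M" "i \<in> {1..n}"
  shows "a i \<le> a n"
proof -
  have "k \<le> n \<Longrightarrow> i \<le> k \<Longrightarrow> a i \<le> a k" for k
  proof (induction k)
    case (Suc k)
    show ?case
    proof (cases "i = Suc k")
      case False
      then have "a i \<le> a k" "k \<in> {1..<n}" using Suc assms(2) by auto
      then show ?thesis using assms(1) by (force simp: strict_chains_def)
    qed simp
  qed (use assms in auto)
  then show ?thesis using assms by simp
qed

text \<open>The last entry of a chain is its largest, so it takes over the role of \<open>M\<close>
  as the bound for the others, lowered by one if step \<open>n\<close> is strict. The assumption
  \<open>0 \<notin> S\<close> matters at \<open>n = 0\<close>: the first entry has no predecessor to
  exceed.\<close>

lemma chains_fun_upd_iff:
  assumes "0 \<notin> S" "a \<in> extensional {1..n}" "v \<le> M"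
  shows "a(Suc n := v) \<in> strict_chains (Suc n) S M \<longleftrightarrow>
    (if n \<in> S then v \<noteq> 0 \<and> a \<in> strict_chains n S (v - 1) else a \<in> strict_chains n S v)"
    (is "?L \<longleftrightarrow> ?R")
proof
  assume L: ?L
  have le: "a i \<le> v" if "i \<in> {1..n}" for i
    using chains_le_last[OF L, of i] that by simp
  have mono: "a i \<le> a (Suc i) \<and> (i \<in> S \<longrightarrow> a i < a (Suc i))" if "i \<in> {1..<n}" for i
  proof -
    have "i \<in> {1..<Suc n}" using that by auto
    with L have "(a(Suc n := v)) i \<le> (a(Suc n := v)) (Suc i) \<and>
       (i \<in> S \<longrightarrow> (a(Suc n := v)) i < (a(Suc n := v)) (Suc i))"
      unfolding strict_chains_def by blast
    then show ?thesis using that by auto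
  qed
  have lt: "a i < v" if "i \<in> {1..n}" "n \<in> S" for i
  proof -
    have "n \<in> {1..<Suc n}" using that by auto
    with L that(2) have "(a(Suc n := v)) n < (a(Suc n := v)) (Suc n)"
      unfolding strict_chains_def by blast
    then have "a n < v" by simp
    moreover have "a i \<le> a n"
    proof -
      have "a \<in> strict_chains n S v"
        using assms(2) le mono by (auto simp: strict_chains_def PiE_def)
      then show ?thesis using chains_le_last that by blast
    qed
    ultimately show ?thesis by simp
  qed
  show ?R
  proof (cases "n \<in> S")
    case True
    then have "n \<in> {1..n}" using assms(1) by (cases n) auto
    then have "v \<noteq> 0" using lt[of n] True by auto
    moreover have "a i \<le> v - 1" if "i \<in> {1..n}" for i using lt[OF that True] by simp
    ultimately show ?thesis using True assms(2) mono by (auto simp: strict_chains_def PiE_def)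
  next
    case False
    then show ?thesis using assms(2) mono le by (auto simp: strict_chains_def PiE_def)
  qed
next
  assume R: ?R
  define w where "w = (if n \<in> S then v - 1 else v)"
  have a: "a \<in> strict_chains n S w" and w: "w \<le> v" "n \<in> S \<Longrightarrow> w < v"
    using R by (auto simp: w_def split: if_splits)
  have b: "a i \<le> w" if "i \<in> {1..n}" for i using a that by (fastforce simp: strict_chains_def)
  have "a(Suc n := v) \<in> {1..Suc n} \<rightarrow>\<^sub>E {0..M}"
    using assms b w by (fastforce simp: PiE_def extensional_def le_Suc_eq)
  moreover have "(a(Suc n := v)) i \<le> (a(Suc n := v)) (Suc i) \<and>
     (i \<in> S \<longrightarrow> (a(Suc n := v)) i < (a(Suc n := v)) (Suc i))" if i: "i \<in> {1..<Suc n}" for i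
  proof (cases "i = n")
    case True
    then show ?thesis using b[of n] w i by auto
  next
    case False
    then show ?thesis using a i by (auto simp: strict_chains_def)
  qed
  ultimately show ?L unfolding strict_chains_def by blast
qed

text \<open>Chains are grouped by their last entry \<open>v\<close>. The value \<open>v = 0\<close>
  is split off in the strict case because truncated \<open>v - 1\<close> would still admit chains
  bounded by \<open>0\<close>.\<close>

lemma sum_chains_Suc:
  fixes g :: "(nat \<Rightarrow> nat) \<Rightarrow> 'a::comm_monoid_add"
  assumes "0 \<notin> S"
  shows "(\<Sum>a\<in>strict_chains (Suc n) S M. g a) =
    (\<Sum>v\<le>M. if n \<in> S then (if v = 0 then 0 else \<Sum>a\<in>strict_chains n S (v - 1). g (a(Suc n := v)))
            else \<Sum>a\<in>strict_chains n S v. g (a(Suc n := v)))"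
proof -
  define T where "T v = (if n \<in> S then (if v = 0 then {} else strict_chains n S (v - 1)) else strict_chains n S v)" for v
  have ext: "a \<in> extensional {1..n}" if "a \<in> T v" for a v
    using that by (auto simp: T_def strict_chains_def PiE_def split: if_splits)
  have T_iff: "a(Suc n := v) \<in> strict_chains (Suc n) S M \<longleftrightarrow> a \<in> T v"
    if "a \<in> extensional {1..n}" "v \<le> M" for a v
    using chains_fun_upd_iff[OF assms that] by (auto simp: T_def)
  have "bij_betw (\<lambda>(v, a). a(Suc n := v)) (SIGMA v:{..M}. T v) (strict_chains (Suc n) S M)"
  \<comment> \<open>Resetting the entry at \<open>Suc n\<close> to \<open>undefined\<close> makes
    the shortened chain extensional on \<open>{1..n}\<close>.\<close>
  proof (rule bij_betw_byWitness[where f' = "\<lambda>a. (a (Suc n), a(Suc n := undefined))"])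
    show "\<forall>z\<in>SIGMA v:{..M}. T v. (\<lambda>a. (a (Suc n), a(Suc n := undefined))) ((\<lambda>(v, a). a(Suc n := v)) z) = z"
      using ext by (fastforce simp: extensional_def fun_eq_iff)
    show "\<forall>a\<in>strict_chains (Suc n) S M. (\<lambda>(v, a). a(Suc n := v)) (a (Suc n), a(Suc n := undefined)) = a"
      by auto
    show "(\<lambda>(v, a). a(Suc n := v)) ` (SIGMA v:{..M}. T v) \<subseteq> strict_chains (Suc n) S M"
      using T_iff ext by auto
    show "(\<lambda>a. (a (Suc n), a(Suc n := undefined))) ` strict_chains (Suc n) S M \<subseteq> (SIGMA v:{..M}. T v)"
    proof clarify
      fix a assume a: "a \<in> strict_chains (Suc n) S M"
      then have "a (Suc n) \<le> M" "a(Suc n := undefined) \<in> extensional {1..n}"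
        by (auto simp: strict_chains_def PiE_def extensional_def Pi_def)
      moreover from this a have "a(Suc n := undefined) \<in> T (a (Suc n))"
        by (subst T_iff[symmetric]) auto
      ultimately show "a (Suc n) \<in> {..M} \<and> a(Suc n := undefined) \<in> T (a (Suc n))" by simp
    qed
  qed
  from sum.reindex_bij_betw[OF this, of g]
  have "(\<Sum>a\<in>strict_chains (Suc n) S M. g a) = (\<Sum>(v, a)\<in>(SIGMA v:{..M}. T v). g (a(Suc n := v)))"
    by (simp add: case_prod_unfold)
  also have "\<dots> = (\<Sum>v\<le>M. \<Sum>a\<in>T v. g (a(Suc n := v)))"
    by (subst sum.Sigma) (auto simp: T_def)
  also have "\<dots> = (\<Sum>v\<le>M. if n \<in> S then (if v = 0 then 0 else \<Sum>a\<in>strict_chains n S (v - 1). g (a(Suc n := v)))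
            else \<Sum>a\<in>strict_chains n S v. g (a(Suc n := v)))"
    by (rule sum.cong) (auto simp: T_def)
  finally show ?thesis .
qed

section \<open>Generating functions of chains as products of gap series\<close>

text \<open>This is \<open>1 / (1 - c X)\<close>, given by coefficients so that it makes sense over
  any commutative ring.\<close>

definition geom :: "'a::comm_ring_1 \<Rightarrow> 'a fps" where
  "geom c = Abs_fps (\<lambda>n. c ^ n)"

lemma geom_mult_one_minus: "geom c * (1 - fps_const c * fps_X) = 1"
proof (rule fps_ext)
  fix k
  have "geom c * (1 - fps_const c * fps_X) = geom c - fps_const c * (geom c * fps_X)"
    by (simp add: algebra_simps)
  then show "fps_nth (geom c * (1 - fps_const c * fps_X)) k = fps_nth 1 k"
    by (cases k) (simp_all add: geom_def)
qed

lemma inverse_one_minus_const_X: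
  "inverse (1 - fps_const c * fps_X) = geom (c::'a::field)"
  using geom_mult_one_minus[of c] by (intro fps_inverse_unique) (simp add: mult.commute)

text \<open>The step from \<open>n\<close> to \<open>n + 1\<close> entries: \<open>h\<close> is the weighted count of shorter chains,
  \<open>c\<close> the weight of the gap before the new entry and \<open>d\<close> that of the gap after it.\<close>

lemma Abs_fps_chain_step:
  fixes h :: "nat \<Rightarrow> 'a::comm_ring_1"
  shows "Abs_fps (\<lambda>M. \<Sum>v\<le>M. (if b then (if v = 0 then 0 else c * h (v - 1)) else h v) * d ^ (M - v)) =
    Abs_fps h * (if b then fps_const c * fps_X else 1) * geom d"
proof -
  define t where "t v = (if b then (if v = 0 then 0 else c * h (v - 1)) else h v)" for v
  \<comment> \<open>A strict step shifts the index by one, which is multiplication by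
    \<open>X\<close>; the value \<open>0\<close> at \<open>v = 0\<close> is the constant coefficient
    of the shifted series.\<close>
  have t: "Abs_fps t = Abs_fps h * (if b then fps_const c * fps_X else 1)"
  proof (cases b)
    case True
    then have "Abs_fps h * (if b then fps_const c * fps_X else 1) = fps_const c * (Abs_fps h * fps_X)"
      by (simp add: algebra_simps)
    then show ?thesis using True by (simp add: fps_eq_iff t_def)
  qed (simp add: t_def[abs_def])
  \<comment> \<open>The sum over \<open>v\<close> is a Cauchy product.\<close>
  have "Abs_fps (\<lambda>M. \<Sum>v\<le>M. t v * d ^ (M - v)) = Abs_fps t * geom d"
    by (simp add: fps_eq_iff fps_mult_nth geom_def atMost_atLeast0)
  then show ?thesis unfolding t by (simp add: t_def)
qed

lemma card_Int_lessThan_Suc: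
  assumes "k \<le> m"
  shows "card (S \<inter> {k..<Suc m}) = card (S \<inter> {k..<m}) + (if m \<in> S then 1 else 0)"
proof -
  have "S \<inter> {k..<Suc m} = (if m \<in> S then insert m (S \<inter> {k..<m}) else S \<inter> {k..<m})"
    using assms by (auto simp: less_Suc_eq)
  then show ?thesis by simp
qed

text \<open>The entries cut the interval from \<open>0\<close> to \<open>M\<close> into
  \<open>n + 1\<close> gaps. With weight \<open>p\<close> per unit of length each gap gives
  \<open>geom p\<close>, and a strict one a further \<open>p X\<close>. This covers the part of a
  chain below a marked entry, whose value acts as the bound.\<close>

lemma Abs_fps_card_chains:
  fixes p :: "'a::comm_ring_1"
  assumes "0 \<notin> S"
  shows "Abs_fps (\<lambda>M. \<Sum>a\<in>strict_chains n S M. p ^ M) =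
    (fps_const p * fps_X) ^ card (S \<inter> {0..<n}) * geom p ^ Suc n"
proof (induction n)
  case 0
  show ?case by (simp add: geom_def)
next
  case (Suc n)
  have "Abs_fps (\<lambda>M. \<Sum>a\<in>strict_chains (Suc n) S M. p ^ M) =
     Abs_fps (\<lambda>M. \<Sum>v\<le>M. (if n \<in> S then (if v = 0 then 0 else p * (\<Sum>a\<in>strict_chains n S (v - 1). p ^ (v - 1)))
        else \<Sum>a\<in>strict_chains n S v. p ^ v) * p ^ (M - v))"
  proof (intro arg_cong[where f = Abs_fps] ext)
    fix M
    show "(\<Sum>a\<in>strict_chains (Suc n) S M. p ^ M) =
      (\<Sum>v\<le>M. (if n \<in> S then (if v = 0 then 0 else p * (\<Sum>a\<in>strict_chains n S (v - 1). p ^ (v - 1)))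
        else \<Sum>a\<in>strict_chains n S v. p ^ v) * p ^ (M - v))"
      unfolding sum_chains_Suc[OF assms]
    proof (rule sum.cong[OF refl])
      fix v assume v: "v \<in> {..M}"
      show "(if n \<in> S then (if v = 0 then 0 else \<Sum>a\<in>strict_chains n S (v - 1). p ^ M)
            else \<Sum>a\<in>strict_chains n S v. p ^ M) =
          (if n \<in> S then (if v = 0 then 0 else p * (\<Sum>a\<in>strict_chains n S (v - 1). p ^ (v - 1)))
            else \<Sum>a\<in>strict_chains n S v. p ^ v) * p ^ (M - v)"
      proof (cases v)
        case (Suc w)
        have "p ^ M = p * p ^ w * p ^ (M - Suc w)"
          using v Suc by (simp flip: power_add power_Suc)
        then show ?thesis using Suc by (simp add: mult_ac)
      qed simp
    qed
  qed
  also have "\<dots> = Abs_fps (\<lambda>M. \<Sum>a\<in>strict_chains n S M. p ^ M) * (if n \<in> S then fps_const p * fps_X else 1) * geom p"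
    by (rule Abs_fps_chain_step)
  also have "\<dots> = (fps_const p * fps_X) ^ card (S \<inter> {0..<Suc n}) * geom p ^ Suc (Suc n)"
    unfolding Suc.IH by (simp add: card_Int_lessThan_Suc mult_ac)
  finally show ?case .
qed

text \<open>The marked entry \<open>a k\<close> has \<open>k\<close> gaps below it, weighted by
  \<open>p\<close>, and \<open>n + 1 - k\<close> above it, weighted by \<open>q\<close>. Step
  \<open>i\<close> joins entries \<open>i\<close> and \<open>i + 1\<close>, so the strict steps
  below are those with \<open>i < k\<close>.\<close>

lemma Abs_fps_sum_chains:
  fixes p q :: "'a::comm_ring_1"
  assumes "0 \<notin> S" "k \<ge> 1" "n \<ge> k"
  shows "Abs_fps (\<lambda>M. \<Sum>a\<in>strict_chains n S M. p ^ a k * q ^ (M - a k)) =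
    (fps_const p * fps_X) ^ card (S \<inter> {0..<k}) * (fps_const q * fps_X) ^ card (S \<inter> {k..<n}) *
    geom p ^ k * geom q ^ (n + 1 - k)"
  using assms(3)
proof (induction n rule: dec_induct)
  case base
  from assms obtain l where k: "k = Suc l" by (cases k) auto
  \<comment> \<open>Here the marked entry is the last one: its value \<open>v\<close> bounds the
    rest, all weighted by \<open>p\<close>, and only the final gap \<open>M - v\<close> carries
    \<open>q\<close>.\<close>
  have "Abs_fps (\<lambda>M. \<Sum>a\<in>strict_chains (Suc l) S M. p ^ a (Suc l) * q ^ (M - a (Suc l))) =
     Abs_fps (\<lambda>M. \<Sum>v\<le>M. (if l \<in> S then (if v = 0 then 0 else p * (\<Sum>a\<in>strict_chains l S (v - 1). p ^ (v - 1)))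
        else \<Sum>a\<in>strict_chains l S v. p ^ v) * q ^ (M - v))"
    unfolding sum_chains_Suc[OF assms(1)]
    by (intro arg_cong[where f = Abs_fps] ext sum.cong) (auto simp: mult_ac power_eq_if)
  also have "\<dots> = Abs_fps (\<lambda>M. \<Sum>a\<in>strict_chains l S M. p ^ M) * (if l \<in> S then fps_const p * fps_X else 1) * geom q"
    by (rule Abs_fps_chain_step)
  finally show ?case
    by (simp only: k Abs_fps_card_chains[OF assms(1)]) (simp add: card_Int_lessThan_Suc mult_ac)
next
  case (step n)
  \<comment> \<open>Subtraction is truncated, so the exponent splits at \<open>v\<close> only
    because \<open>a k \<le> v \<le> M\<close>.\<close>
  have q: "q ^ (M - a k) = q ^ (v - a k) * q ^ (M - v)" if "a k \<le> v" "v \<le> M" for a :: "nat \<Rightarrow> nat" and M v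
    using that by (simp flip: power_add)
  have le: "a k \<le> v" if "a \<in> strict_chains n S v" for a v
    using that step assms(2) by (fastforce simp: strict_chains_def)
  have summand: "(if n \<in> S then (if v = 0 then 0 else \<Sum>a\<in>strict_chains n S (v - 1). p ^ a k * q ^ (M - a k))
          else \<Sum>a\<in>strict_chains n S v. p ^ a k * q ^ (M - a k)) =
        (if n \<in> S then (if v = 0 then 0 else q * (\<Sum>a\<in>strict_chains n S (v - 1). p ^ a k * q ^ (v - 1 - a k)))
        else \<Sum>a\<in>strict_chains n S v. p ^ a k * q ^ (v - a k)) * q ^ (M - v)" if "v \<le> M" for v M
  proof -
    have 1: "(\<Sum>a\<in>strict_chains n S v. p ^ a k * q ^ (M - a k)) = (\<Sum>a\<in>strict_chains n S v. p ^ a k * q ^ (v - a k)) * q ^ (M - v)"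
      unfolding sum_distrib_right by (intro sum.cong refl) (simp only: q[OF le that] mult.assoc)
    have 2: "(\<Sum>a\<in>strict_chains n S (v - 1). p ^ a k * q ^ (M - a k)) =
       q * (\<Sum>a\<in>strict_chains n S (v - 1). p ^ a k * q ^ (v - 1 - a k)) * q ^ (M - v)" if "v \<noteq> 0"
      unfolding sum_distrib_right sum_distrib_left
    proof (intro sum.cong refl)
      fix a assume "a \<in> strict_chains n S (v - 1)"
      then have "a k \<le> v - 1" by (rule le)
      \<comment> \<open>The summand \<open>1\<close> is the unit between the bound
        \<open>v - 1\<close> and the new entry \<open>v\<close>.\<close>
      then have "M - a k = 1 + (v - 1 - a k) + (M - v)" using that \<open>v \<le> M\<close> by simp
      then show "p ^ a k * q ^ (M - a k) = q * (p ^ a k * q ^ (v - 1 - a k)) * q ^ (M - v)"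
        by (simp only: power_add) (simp add: mult_ac)
    qed
    show ?thesis using 1 2 by simp
  qed
  have "Abs_fps (\<lambda>M. \<Sum>a\<in>strict_chains (Suc n) S M. p ^ a k * q ^ (M - a k)) =
     Abs_fps (\<lambda>M. \<Sum>v\<le>M. (if n \<in> S then (if v = 0 then 0 else q * (\<Sum>a\<in>strict_chains n S (v - 1). p ^ a k * q ^ (v - 1 - a k)))
        else \<Sum>a\<in>strict_chains n S v. p ^ a k * q ^ (v - a k)) * q ^ (M - v))"
  proof (intro arg_cong[where f = Abs_fps] ext)
    fix M
    have "(\<Sum>a\<in>strict_chains (Suc n) S M. p ^ a k * q ^ (M - a k)) =
      (\<Sum>v\<le>M. if n \<in> S then (if v = 0 then 0 else \<Sum>a\<in>strict_chains n S (v - 1). p ^ a k * q ^ (M - a k))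
          else \<Sum>a\<in>strict_chains n S v. p ^ a k * q ^ (M - a k))"
      using step by (subst sum_chains_Suc[OF assms(1)]) (auto intro!: sum.cong)
    also have "\<dots> = (\<Sum>v\<le>M. (if n \<in> S then (if v = 0 then 0 else q * (\<Sum>a\<in>strict_chains n S (v - 1). p ^ a k * q ^ (v - 1 - a k)))
        else \<Sum>a\<in>strict_chains n S v. p ^ a k * q ^ (v - a k)) * q ^ (M - v))"
      by (intro sum.cong refl summand) simp
    finally show "(\<Sum>a\<in>strict_chains (Suc n) S M. p ^ a k * q ^ (M - a k)) = \<dots>" .
  qed
  also have "\<dots> = Abs_fps (\<lambda>M. \<Sum>a\<in>strict_chains n S M. p ^ a k * q ^ (M - a k)) *
      (if n \<in> S then fps_const q * fps_X else 1) * geom q"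
    by (rule Abs_fps_chain_step)
  finally show ?case
    using assms(1) step by (simp add: step.IH card_Int_lessThan_Suc Suc_diff_le mult_ac)
qed

section \<open>Standardization\<close>

text \<open>The value \<open>j\<close> outside \<open>{1..n}\<close> is the one that
  \<open>permutes\<close> requires.\<close>

definition rank :: "nat \<Rightarrow> (nat \<Rightarrow> nat) \<Rightarrow> nat \<Rightarrow> nat" where
  "rank n key j = (if j \<in> {1..n} then card {i \<in> {1..n}. key i \<le> key j} else j)"

lemma rank_less:
  assumes "i \<in> {1..n}" "j \<in> {1..n}" "key i < key j"
  shows "rank n key i < rank n key j"
proof -
  have "{l \<in> {1..n}. key l \<le> key i} \<subset> {l \<in> {1..n}. key l \<le> key j}"
    by (rule psubsetI) (use assms in \<open>auto simp: set_eq_iff intro!: exI[of _ j]\<close>)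
  then show ?thesis using assms by (simp add: rank_def psubset_card_mono)
qed

lemma rank_less_iff:
  assumes "i \<in> {1..n}" "j \<in> {1..n}"
  shows "rank n key i < rank n key j \<longleftrightarrow> key i < key j"
proof -
  have "key j \<le> key i \<Longrightarrow> rank n key j \<le> rank n key i"
    using assms by (auto simp: rank_def intro!: card_mono)
  then show ?thesis using rank_less[OF assms] by (metis not_le)
qed

lemma rank_permutes:
  assumes "inj_on key {1..n}"
  shows "rank n key permutes {1..n}"
proof (rule bij_imp_permutes)
  have inj: "inj_on (rank n key) {1..n}"
    by (smt (verit) assms inj_on_def rank_less_iff linorder_neqE_nat less_irrefl)
  have sub: "rank n key ` {1..n} \<subseteq> {1..n}"
  proof clarify
    fix j assume j: "j \<in> {1..n}"
    have "card {i \<in> {1..n}. key i \<le> key j} \<le> n"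
      by (rule order_trans[OF card_mono[of "{1..n}"]]) auto
    moreover have "card {i \<in> {1..n}. key i \<le> key j} \<noteq> 0" using j by auto
    ultimately show "rank n key j \<in> {1..n}" 
      using j unfolding rank_def if_P[OF j] by (intro atLeastAtMost_iff[THEN iffD2]) linarith
  qed
  show "bij_betw (rank n key) {1..n} {1..n}"
    using inj sub by (simp add: bij_betw_def endo_inj_surj)
qed (auto simp: rank_def)

text \<open>If the keys increase along \<open>inv u 1, ..., inv u n\<close>, then the positions with
  key at most \<open>key j\<close> are the first \<open>u j\<close> in this list, so their number is
  \<open>u j\<close>.\<close>

lemma rank_eqI:
  assumes u: "u permutes {1..n}"
    and less: "\<And>i. i \<in> {1..<n} \<Longrightarrow> key (inv u i) < key (inv u (Suc i))"
  shows "rank n key = u"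
proof
  fix j
  have mono: "key (inv u i) < key (inv u k)" if "1 \<le> i" "i < k" "k \<le> n" for i k
    using that(2,3)
  proof (induction k)
    case (Suc k)
    then show ?case using less[of k] that(1) by (cases "i = k") (auto intro: less_trans)
  qed simp
  show "rank n key j = u j"
  proof (cases "j \<in> {1..n}")
    case True
    have uj: "u j \<in> {1..n}" using True permutes_in_image[OF u] by blast
    have "{i \<in> {1..n}. key i \<le> key j} = inv u ` {1..u j}"
    proof (intro equalityI subsetI)
      fix i assume i: "i \<in> {i \<in> {1..n}. key i \<le> key j}"
      then have ui: "u i \<in> {1..n}" using permutes_in_image[OF u] by blast
      have "u i \<le> u j"
        using i mono[of "u j" "u i"] ui uj permutes_inverses(2)[OF u] by force
      then show "i \<in> inv u ` {1..u j}"
        using ui permutes_inverses(2)[OF u] by (intro image_eqI[of _ _ "u i"]) auto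
    next
      fix i assume "i \<in> inv u ` {1..u j}"
      then obtain l where l: "i = inv u l" "1 \<le> l" "l \<le> u j" by auto
      then have "l \<in> {1..n}" using uj by auto
      then have "i \<in> {1..n}" using l permutes_in_image[OF permutes_inv[OF u]] by blast
      moreover have "key i \<le> key j"
        using mono[of l "u j"] l uj permutes_inverses(2)[OF u] by (cases "l = u j") auto
      ultimately show "i \<in> {i \<in> {1..n}. key i \<le> key j}" by simp
    qed
    moreover have "inj_on (inv u) {1..u j}"
      using permutes_inj[OF permutes_inv[OF u]] by (rule inj_on_subset) simp
    ultimately show ?thesis using True by (simp add: rank_def card_image)
  next
    case False
    then have "u j = j" by (rule permutes_not_in[OF u])
    then show ?thesis using False by (simp only: rank_def if_False)
  qed
qed

section \<open>Standardization with ties broken by the zigzag labelling\<close>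

text \<open>The natural labelling of the zigzag poset, shifted down by one; for even \<open>n\<close> its values on
  \<open>{1..n}\<close> are not an interval.\<close>

definition lab :: "nat \<Rightarrow> nat" where
  "lab j = (if even j then j + 1 else j - 1)"

text \<open>The lexicographic order on pairs \<open>(f j, lab j)\<close>, coded as one number. The
  base \<open>n + 2\<close> suffices since \<open>lab j \<le> n + 1\<close> for
  \<open>j \<le> n\<close>.\<close>

definition key :: "nat \<Rightarrow> (nat \<Rightarrow> nat) \<Rightarrow> nat \<Rightarrow> nat" where
  "key n f j = f j * (n + 2) + lab j"

lemma key_less_iff:
  assumes "i \<in> {1..n}" "j \<in> {1..n}"
  shows "key n f i < key n f j \<longleftrightarrow> f i < f j \<or> f i = f j \<and> lab i < lab j"
proof -
  have lab: "lab i < n + 2" "lab j < n + 2" using assms by (auto simp: lab_def)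
  have lt: "a * (n + 2) + b < c * (n + 2) + d" if "a < c" "b < n + 2" for a b c d
  proof -
    have "a * (n + 2) + b < Suc a * (n + 2)" using that by simp
    also have "\<dots> \<le> c * (n + 2)" using that by (intro mult_right_mono) auto
    finally show ?thesis by simp
  qed
  show ?thesis
    using lt[of "f i" "f j" "lab i" "lab j"] lt[of "f j" "f i" "lab j" "lab i"] lab
    unfolding key_def by (cases "f i" "f j" rule: linorder_cases) auto
qed

lemma lab_inj: "inj_on lab {1..n}"
  by (rule inj_onI) (auto simp: lab_def split: if_splits elim!: oddE evenE, presburger+)

lemma key_inj: "inj_on (key n f) {1..n}"
proof (rule inj_onI)
  fix i j assume ij: "i \<in> {1..n}" "j \<in> {1..n}" "key n f i = key n f j"
  then have "f i = f j \<and> lab i = lab j"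
    using key_less_iff[of i n j f] key_less_iff[of j n i f] by auto
  then show "i = j" using inj_onD[OF lab_inj _ ij(1,2)] by blast
qed

abbreviation std :: "nat \<Rightarrow> (nat \<Rightarrow> nat) \<Rightarrow> nat \<Rightarrow> nat" where
  "std n f \<equiv> rank n (key n f)"

text \<open>Between neighbours \<open>lab\<close> increases in the direction in which
  \<open>f\<close> increases weakly, so every tie is broken as the strict alternation
  demands.\<close>

lemma std_alt_perms:
  assumes "f \<in> alt_maps n m"
  shows "std n f \<in> alt_perms n"
  unfolding alt_perms_def
proof (intro CollectI conjI ballI impI)
  show "std n f permutes {1..n}" by (rule rank_permutes[OF key_inj])
next
  fix j assume j: "j \<in> {1..n - 1}" and "odd j"
  then have "f j \<le> f (j + 1)" "lab j < lab (j + 1)" using assms by (auto simp: alt_maps_def lab_def)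
  moreover have "j \<in> {1..n}" "j + 1 \<in> {1..n}" using j by auto
  ultimately show "std n f j < std n f (j + 1)" by (auto simp: rank_less_iff key_less_iff)
next
  fix j assume j: "j \<in> {1..n - 1}" and "even j"
  then have "f (j + 1) \<le> f j" "lab (j + 1) < lab j" using assms by (auto simp: alt_maps_def lab_def)
  moreover have "j \<in> {1..n}" "j + 1 \<in> {1..n}" using j by auto
  ultimately show "std n f j > std n f (j + 1)" by (auto simp: rank_less_iff key_less_iff)
qed

text \<open>A strict comparison of keys forces the weak comparison of values. This puts a map built
  from a chain into \<open>alt_maps\<close>.\<close>

lemma std_alt_perms_imp_alt_maps:
  assumes "f \<in> {1..n} \<rightarrow>\<^sub>E {1..m}" "std n f \<in> alt_perms n"
  shows "f \<in> alt_maps n m"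
  unfolding alt_maps_def
proof (intro CollectI conjI ballI impI)
  fix j assume j: "j \<in> {1..n - 1}" and "odd j"
  then have "std n f j < std n f (j + 1)" using assms by (auto simp: alt_perms_def)
  moreover have "j \<in> {1..n}" "j + 1 \<in> {1..n}" using j by auto
  ultimately show "f j \<le> f (j + 1)" by (auto simp: rank_less_iff key_less_iff)
next
  fix j assume j: "j \<in> {1..n - 1}" and "even j"
  then have "std n f (j + 1) < std n f j" using assms by (auto simp: alt_perms_def)
  moreover have "j \<in> {1..n}" "j + 1 \<in> {1..n}" using j by auto
  ultimately show "f j \<ge> f (j + 1)" by (auto simp: rank_less_iff key_less_iff)
qed (use assms in auto)

section \<open>Returns as label descents, and the fibres of standardization\<close>

text \<open>The orders by \<open>lab\<close> and by position agree except on pairs \<open>j\<close>,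
  \<open>j + 1\<close> with \<open>j\<close> even. If \<open>i\<close> and \<open>i + 1\<close> sit
  at adjacent positions, there is no return, and the alternation of \<open>u\<close> forces
  \<open>lab\<close> to increase from \<open>i\<close> to \<open>i + 1\<close>.\<close>

lemma Ret1_eq_lab_descent:
  assumes u: "u \<in> alt_perms n" and i: "i \<in> {1..<n}"
  shows "i \<in> Ret1 n u \<longleftrightarrow> lab (inv u (Suc i)) < lab (inv u i)"
    and "lab (inv u (Suc i)) \<noteq> lab (inv u i)"
proof -
  have perm: "u permutes {1..n}" using u by (simp add: alt_perms_def)
  define a b where "a = inv u i" and "b = inv u (Suc i)"
  have ua: "u a = i" and ub: "u b = Suc i"
    using permutes_inverses(1)[OF perm] by (auto simp: a_def b_def)
  have ab: "a \<in> {1..n}" "b \<in> {1..n}"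
    using i permutes_in_image[OF permutes_inv[OF perm]] by (auto simp: a_def b_def)
  have ne: "a \<noteq> b" using ua ub by auto
  \<comment> \<open>Both facts concern adjacent positions: the excluded parity would give
    \<open>u b < u a\<close>, although \<open>u b\<close> is the larger value.\<close>
  have 1: "a \<noteq> Suc b \<or> even b"
  proof (rule ccontr)
    assume "\<not> ?thesis"
    then have "b \<in> {1..n - 1}" "odd b" "a = b + 1" using ab by auto
    then have "u b < u a" using u by (auto simp: alt_perms_def)
    then show False using ua ub by simp
  qed
  have 2: "b \<noteq> Suc a \<or> odd a"
  proof (rule ccontr)
    assume "\<not> ?thesis"
    then have "a \<in> {1..n - 1}" "even a" "b = a + 1" using ab by auto
    then have "u b < u a" using u by (auto simp: alt_perms_def)
    then show False using ua ub by simp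
  qed
  show "lab (inv u (Suc i)) \<noteq> lab (inv u i)"
    using lab_inj[of n] ab ne unfolding a_def[symmetric] b_def[symmetric] by (auto dest: inj_onD)
  have "a > b + 1 \<longleftrightarrow> lab b < lab a"
    using 1 2 ne ab unfolding lab_def by (auto elim!: evenE oddE; presburger)
  then show "i \<in> Ret1 n u \<longleftrightarrow> lab (inv u (Suc i)) < lab (inv u i)"
    using i by (auto simp: Ret1_def a_def b_def)
qed

text \<open>The condition \<open>std n f = u\<close> means that the keys increase along
  \<open>inv u\<close>. At a tie of \<open>f\<close> the labels decide, and they decrease exactly at
  \<open>Ret1 n u\<close>, where the step must therefore be strict.\<close>

lemma std_eq_iff:
  assumes u: "u \<in> alt_perms n"
  shows "std n f = u \<longleftrightarrow> (\<forall>i\<in>{1..<n}. f (inv u i) \<le> f (inv u (Suc i)) \<and>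
    (i \<in> Ret1 n u \<longrightarrow> f (inv u i) < f (inv u (Suc i))))"
proof -
  have perm: "u permutes {1..n}" using u by (simp add: alt_perms_def)
  have in_range: "inv u i \<in> {1..n}" if "i \<in> {1..n}" for i
    using that permutes_in_image[OF permutes_inv[OF perm]] by blast
  have iff: "key n f (inv u i) < key n f (inv u (Suc i)) \<longleftrightarrow> f (inv u i) \<le> f (inv u (Suc i)) \<and>
      (i \<in> Ret1 n u \<longrightarrow> f (inv u i) < f (inv u (Suc i)))" if i: "i \<in> {1..<n}" for i
    using key_less_iff[OF in_range[of i] in_range[of "Suc i"], of f] Ret1_eq_lab_descent[OF u i] i
    by auto
  have "std n f = u \<longleftrightarrow> (\<forall>i\<in>{1..<n}. key n f (inv u i) < key n f (inv u (Suc i)))"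
  proof
    assume s: "std n f = u"
    show "\<forall>i\<in>{1..<n}. key n f (inv u i) < key n f (inv u (Suc i))"
    proof
      fix i assume i: "i \<in> {1..<n}"
      have "u (inv u i) < u (inv u (Suc i))" using permutes_inverses(1)[OF perm] by simp
      then show "key n f (inv u i) < key n f (inv u (Suc i))"
        using rank_less_iff[OF in_range[of i] in_range[of "Suc i"], of "key n f"] i s by simp
    qed
  next
    assume "\<forall>i\<in>{1..<n}. key n f (inv u i) < key n f (inv u (Suc i))"
    then show "std n f = u" by (intro rank_eqI[OF perm]) auto
  qed
  then show ?thesis using iff by auto
qed

text \<open>Reading \<open>f\<close> along \<open>inv u\<close> turns the fibre condition into the
  chain condition. \<open>Suc\<close> passes from values starting at \<open>0\<close> to values
  starting at \<open>1\<close>, whence \<open>Suc M\<close>.\<close>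

lemma bij_betw_chains_std_fibre:
  assumes u: "u \<in> alt_perms n"
  shows "bij_betw (\<lambda>a. \<lambda>j\<in>{1..n}. Suc (a (u j))) (strict_chains n (Ret1 n u) M)
    {f \<in> alt_maps n (Suc M). std n f = u}"
proof -
  have perm: "u permutes {1..n}" using u by (simp add: alt_perms_def)
  have inv_range: "inv u i \<in> {1..n} \<longleftrightarrow> i \<in> {1..n}" for i
    by (rule permutes_in_image[OF permutes_inv[OF perm]])
  have u_range: "u i \<in> {1..n} \<longleftrightarrow> i \<in> {1..n}" for i
    by (rule permutes_in_image[OF perm])
  note inverses [simp] = permutes_inverses[OF perm]
  let ?F = "\<lambda>a. \<lambda>j\<in>{1..n}. Suc (a (u j))" and ?B = "\<lambda>f. \<lambda>i\<in>{1..n}. f (inv u i) - 1"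
  show ?thesis
  proof (rule bij_betw_byWitness[where f' = ?B])
    show "\<forall>a\<in>strict_chains n (Ret1 n u) M. ?B (?F a) = a"
      using inv_range by (auto simp: fun_eq_iff strict_chains_def PiE_def extensional_def restrict_def)
    show "\<forall>f\<in>{f \<in> alt_maps n (Suc M). std n f = u}. ?F (?B f) = f"
    proof
      fix f assume "f \<in> {f \<in> alt_maps n (Suc M). std n f = u}"
      then have f: "f \<in> {1..n} \<rightarrow>\<^sub>E {1..Suc M}" by (simp add: alt_maps_def)
      show "?F (?B f) = f"
      proof
        fix j
        show "?F (?B f) j = f j"
        proof (cases "j \<in> {1..n}")
          case True
          then have "f j \<in> {1..Suc M}" using f by blast
          then show ?thesis using True u_range[of j] by simp
        next
          case False
          then show ?thesis using f by (auto simp: PiE_def extensional_def)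
        qed
      qed
    qed
    show "?F ` strict_chains n (Ret1 n u) M \<subseteq> {f \<in> alt_maps n (Suc M). std n f = u}"
    proof clarify
      fix a assume a: "a \<in> strict_chains n (Ret1 n u) M"
      have val: "?F a (inv u i) = Suc (a i)" if "i \<in> {1..n}" for i
        using inv_range[of i] that by simp
      have std: "std n (?F a) = u"
        unfolding std_eq_iff[OF u]
      proof
        fix i assume i: "i \<in> {1..<n}"
        then have "i \<in> {1..n}" "Suc i \<in> {1..n}" by auto
        note vals = this[THEN val]
        show "?F a (inv u i) \<le> ?F a (inv u (Suc i)) \<and>
          (i \<in> Ret1 n u \<longrightarrow> ?F a (inv u i) < ?F a (inv u (Suc i)))"
          unfolding vals using a i by (simp add: strict_chains_def)
      qed
      moreover have "?F a \<in> {1..n} \<rightarrow>\<^sub>E {1..Suc M}"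
      proof (rule restrict_PiE_iff[THEN iffD2], rule ballI)
        fix j assume "j \<in> {1..n}"
        then have "u j \<in> {1..n}" using u_range by blast
        then have "a (u j) \<in> {0..M}" using a unfolding strict_chains_def by blast
        then show "Suc (a (u j)) \<in> {1..Suc M}" by simp
      qed
      ultimately show "?F a \<in> alt_maps n (Suc M) \<and> std n (?F a) = u"
        using std_alt_perms_imp_alt_maps u by auto
    qed
    show "?B ` {f \<in> alt_maps n (Suc M). std n f = u} \<subseteq> strict_chains n (Ret1 n u) M"
    proof clarify
      fix f assume f: "f \<in> alt_maps n (Suc M)" and s: "u = std n f"
      \<comment> \<open>Values are at least \<open>1\<close>, so subtracting \<open>1\<close>
        preserves strict inequalities.\<close>
      have rng: "f (inv u i) \<in> {1..Suc M}" if "i \<in> {1..n}" for i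
        using f inv_range[of i] that unfolding alt_maps_def by blast
      have "?B f i \<le> ?B f (Suc i) \<and> (i \<in> Ret1 n u \<longrightarrow> ?B f i < ?B f (Suc i))"
        if i: "i \<in> {1..<n}" for i
      proof -
        have "f (inv u i) \<le> f (inv u (Suc i)) \<and>
            (i \<in> Ret1 n u \<longrightarrow> f (inv u i) < f (inv u (Suc i)))"
          using std_eq_iff[OF u, of f] s[symmetric] i by blast
        then show ?thesis using i rng[of i] rng[of "Suc i"] by auto
      qed
      moreover have "?B f \<in> {1..n} \<rightarrow>\<^sub>E {0..M}"
        using rng by (fastforce simp: restrict_PiE_iff)
      ultimately have "?B f \<in> strict_chains n (Ret1 n u) M"
        unfolding strict_chains_def by blast
      then show "(\<lambda>i\<in>{1..n}. f (inv (std n f) i) - 1) \<in> strict_chains n (Ret1 n (std n f)) M"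
        using s by simp
    qed
  qed
qed

section \<open>The generating function\<close>

lemma finite_alt_maps [simp]: "finite (alt_maps n m)"
  by (rule finite_subset[of _ "{1..n} \<rightarrow>\<^sub>E {1..m}"]) (auto simp: alt_maps_def intro: finite_PiE)

lemma finite_alt_perms [simp]: "finite (alt_perms n)"
  by (rule finite_subset[OF _ finite_permutations[of "{1..n}"]]) (auto simp: alt_perms_def)

text \<open>The maps are grouped by their standardization. Since \<open>f 1 = a (u 1) + 1\<close>,
  the exponents of \<open>p\<close> and \<open>q\<close> are \<open>a (u 1) + 1\<close> and
  \<open>M - a (u 1) + 1\<close>, which releases the factor \<open>p * q\<close>.\<close>

lemma Omega_Suc_eq_sum_chains:
  fixes p q :: "'a::comm_ring_1"
  assumes "n \<ge> 1"
  shows "Omega n p q (Suc M) =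
    p * q * (\<Sum>u\<in>alt_perms n. \<Sum>a\<in>strict_chains n (Ret1 n u) M. p ^ a (u 1) * q ^ (M - a (u 1)))"
proof -
  define g where "g f = p ^ f 1 * q ^ (Suc M + 1 - f 1)" for f :: "nat \<Rightarrow> nat"
  have "Omega n p q (Suc M) =
      (\<Sum>u\<in>alt_perms n. \<Sum>f\<in>{f \<in> alt_maps n (Suc M). std n f = u}. g f)"
    unfolding Omega_def g_def
    by (rule sum.group[symmetric]) (auto intro: std_alt_perms)
  also have "\<dots> = (\<Sum>u\<in>alt_perms n. \<Sum>a\<in>strict_chains n (Ret1 n u) M. p * q * (p ^ a (u 1) * q ^ (M - a (u 1))))"
  proof (rule sum.cong[OF refl])
    fix u assume u: "u \<in> alt_perms n"
    then have u1: "u 1 \<in> {1..n}"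
      using permutes_in_image[of u "{1..n}" 1] assms by (auto simp: alt_perms_def)
    show "(\<Sum>f\<in>{f \<in> alt_maps n (Suc M). std n f = u}. g f) =
      (\<Sum>a\<in>strict_chains n (Ret1 n u) M. p * q * (p ^ a (u 1) * q ^ (M - a (u 1))))"
      unfolding sum.reindex_bij_betw[OF bij_betw_chains_std_fibre[OF u], symmetric]
    proof (intro sum.cong refl)
      fix a assume "a \<in> strict_chains n (Ret1 n u) M"
      then have "a (u 1) \<in> {0..M}" using u1 unfolding strict_chains_def by blast
      then show "g (\<lambda>j\<in>{1..n}. Suc (a (u j))) = p * q * (p ^ a (u 1) * q ^ (M - a (u 1)))"
        using assms by (simp add: g_def Suc_diff_le mult_ac)
    qed
  qed
  finally show ?thesis by (simp add: sum_distrib_left)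
qed

text \<open>The value \<open>u 1\<close> itself is never a big return, since \<open>inv u (u 1) = 1\<close>; so it does not
  matter on which side it is counted.\<close>

lemma ret1_eq_card:
  assumes "u \<in> alt_perms n" "n \<ge> 1"
  shows "ret1_minus n u = card (Ret1 n u \<inter> {0..<u 1})"
    and "ret1_plus n u = card (Ret1 n u \<inter> {u 1..<n})"
proof -
  have "inv u (u 1) = 1" using assms permutes_inverses(2) by (auto simp: alt_perms_def)
  then have u1: "u 1 \<notin> Ret1 n u" by (simp add: Ret1_def)
  have range: "i \<in> Ret1 n u \<Longrightarrow> 1 \<le> i \<and> i \<le> n - 1" for i by (simp add: Ret1_def)
  have "Ret1 n u \<inter> {1..u 1} = Ret1 n u \<inter> {0..<u 1}"
    using u1 range by (auto simp: le_less)
  then show "ret1_minus n u = card (Ret1 n u \<inter> {0..<u 1})" by (simp add: ret1_minus_def)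
  have "i \<in> {u 1 + 1..n - 1} \<longleftrightarrow> i \<in> {u 1..<n}" if "i \<in> Ret1 n u" for i
    using u1 range[OF that] that by (cases "i = u 1") auto
  then have "Ret1 n u \<inter> {u 1 + 1..n - 1} = Ret1 n u \<inter> {u 1..<n}" by blast
  then show "ret1_plus n u = card (Ret1 n u \<inter> {u 1..<n})" by (simp add: ret1_plus_def)
qed

lemma G_eq_sum_geom:
  fixes p q :: "'a::comm_ring_1"
  assumes "n \<ge> 1"
  shows "G n p q = (\<Sum>u\<in>alt_perms n. fps_const p * fps_const q * fps_X *
    ((fps_const p * fps_X) ^ ret1_minus n u * (fps_const q * fps_X) ^ ret1_plus n u *
     geom p ^ u 1 * geom q ^ (n + 1 - u 1)))"
proof -
  define H where "H u = Abs_fps (\<lambda>M. \<Sum>a\<in>strict_chains n (Ret1 n u) M. p ^ a (u 1) * q ^ (M - a (u 1)))" for u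
  \<comment> \<open>The shift from \<open>M\<close> to \<open>m = Suc M\<close> gives the factor
    \<open>X\<close>; the constant coefficient vanishes by definition of \<open>G\<close>.\<close>
  have "G n p q = fps_const (p * q) * ((\<Sum>u\<in>alt_perms n. H u) * fps_X)"
  proof (rule fps_ext)
    fix m
    show "fps_nth (G n p q) m = fps_nth (fps_const (p * q) * ((\<Sum>u\<in>alt_perms n. H u) * fps_X)) m"
      using assms by (cases m) (simp_all add: G_def H_def Omega_Suc_eq_sum_chains fps_sum_nth)
  qed
  also have "\<dots> = (\<Sum>u\<in>alt_perms n. fps_const p * fps_const q * fps_X * H u)"
    by (simp add: sum_distrib_left sum_distrib_right mult_ac)
  also have "\<dots> = (\<Sum>u\<in>alt_perms n. fps_const p * fps_const q * fps_X *
    ((fps_const p * fps_X) ^ ret1_minus n u * (fps_const q * fps_X) ^ ret1_plus n u *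
     geom p ^ u 1 * geom q ^ (n + 1 - u 1)))"
  proof (intro sum.cong refl)
    fix u assume u: "u \<in> alt_perms n"
    then have "u 1 \<in> {1..n}"
      using permutes_in_image[of u "{1..n}" 1] assms by (auto simp: alt_perms_def)
    then show "fps_const p * fps_const q * fps_X * H u = fps_const p * fps_const q * fps_X *
      ((fps_const p * fps_X) ^ ret1_minus n u * (fps_const q * fps_X) ^ ret1_plus n u *
       geom p ^ u 1 * geom q ^ (n + 1 - u 1))"
      unfolding H_def ret1_eq_card[OF u assms]
      \<comment> \<open>The marked entry is \<open>k = u 1\<close>.\<close>
      by (subst Abs_fps_sum_chains) (auto simp: Ret1_def)
  qed
  finally show ?thesis .
qed

text \<open>It remains to turn the series \<open>geom\<close> into quotients. In the second equality
  the factor \<open>(1 - Q * x) ^ u 1\<close> from \<open>U\<close> cancels \<open>u 1\<close> of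
  the \<open>n + 1\<close> factors \<open>geom q\<close>.\<close>

theorem theorem4p2:
  fixes n :: nat and p q :: "'a::field" and P Q x :: "'a fps"
  assumes "n \<ge> 1"
  defines "x \<equiv> fps_X" and "P \<equiv> fps_const p" and "Q \<equiv> fps_const q"
  shows "G n p q =
           (\<Sum>u\<in>alt_perms n. P * Q * x *
              (((P * x) ^ ret1_minus n u * (Q * x) ^ ret1_plus n u) /
               ((1 - P * x) ^ u 1 * (1 - Q * x) ^ (n + 1 - u 1)))) \<and>
         (\<Sum>u\<in>alt_perms n. P * Q * x *
              (((P * x) ^ ret1_minus n u * (Q * x) ^ ret1_plus n u) /
               ((1 - P * x) ^ u 1 * (1 - Q * x) ^ (n + 1 - u 1)))) =
         (P * Q * x * U n (P * x) (Q * x)) / (1 - Q * x) ^ (n + 1)"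
proof -
  have unit: "fps_nth (1 - P * x) 0 = 1" "fps_nth (1 - Q * x) 0 = 1" by (simp_all add: x_def P_def Q_def)
  have inv: "inverse (1 - P * x) = geom p" "inverse (1 - Q * x) = geom q"
    by (simp_all add: x_def P_def Q_def inverse_one_minus_const_X)
  have cancel: "geom q * (1 - Q * x) = 1" by (simp add: x_def Q_def geom_mult_one_minus)
  \<comment> \<open>The denominators have constant coefficient \<open>1\<close>, so division is
    multiplication by the inverse.\<close>
  have div: "A / ((1 - P * x) ^ i * (1 - Q * x) ^ j) = A * geom p ^ i * geom q ^ j" for A i j
  proof -
    have "fps_nth ((1 - P * x) ^ i * (1 - Q * x) ^ j) 0 = 1"
      by (simp add: fps_nth_power_0 unit del: fps_sub_nth)
    then show ?thesis
      by (simp add: fps_divide_unit fps_inverse_mult fps_inverse_power inv mult_ac)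
  qed
  have 1: "G n p q = (\<Sum>u\<in>alt_perms n. P * Q * x *
              (((P * x) ^ ret1_minus n u * (Q * x) ^ ret1_plus n u) /
               ((1 - P * x) ^ u 1 * (1 - Q * x) ^ (n + 1 - u 1))))"
    unfolding div unfolding G_eq_sum_geom[OF assms(1)] P_def Q_def x_def by simp
  have U: "U n (P * x) (Q * x) = (\<Sum>u\<in>alt_perms n.
      (P * x) ^ ret1_minus n u * (Q * x) ^ ret1_plus n u * ((1 - Q * x) * geom p) ^ u 1)"
    using div[of "1 - Q * x" 1 0] by (simp add: U_def)
  have "(P * Q * x * U n (P * x) (Q * x)) / (1 - Q * x) ^ (n + 1) =
      P * Q * x * U n (P * x) (Q * x) * geom q ^ (n + 1)"
    using div[of _ 0 "n + 1"] by simp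
  also have "\<dots> = (\<Sum>u\<in>alt_perms n. P * Q * x *
      ((P * x) ^ ret1_minus n u * (Q * x) ^ ret1_plus n u * geom p ^ u 1 * geom q ^ (n + 1 - u 1)))"
    unfolding U sum_distrib_left sum_distrib_right
  proof (intro sum.cong refl)
    fix u assume u: "u \<in> alt_perms n"
    then have "u 1 \<in> {1..n}"
      using permutes_in_image[of u "{1..n}" 1] assms by (auto simp: alt_perms_def)
    \<comment> \<open>The bound \<open>u 1 \<le> n\<close> makes the truncated exponent
      exact.\<close>
    then have "geom q ^ (n + 1) = geom q ^ u 1 * geom q ^ (n + 1 - u 1)"
      by (simp flip: power_add)
    moreover have "geom q ^ u 1 * (1 - Q * x) ^ u 1 = 1"
      by (simp only: cancel power_one flip: power_mult_distrib)
    ultimately have split: "(1 - Q * x) ^ u 1 * geom q ^ (n + 1) = geom q ^ (n + 1 - u 1)"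
      by (simp only: mult.assoc[symmetric] mult.commute[of "(1 - Q * x) ^ u 1"] mult_1_left)
    have "P * Q * x * ((P * x) ^ ret1_minus n u * (Q * x) ^ ret1_plus n u *
        ((1 - Q * x) * geom p) ^ u 1) * geom q ^ (n + 1) =
      P * Q * x * ((P * x) ^ ret1_minus n u * (Q * x) ^ ret1_plus n u * geom p ^ u 1) *
        ((1 - Q * x) ^ u 1 * geom q ^ (n + 1))"
      unfolding power_mult_distrib[of "1 - Q * x"] by (simp only: mult_ac)
    then show "P * Q * x * ((P * x) ^ ret1_minus n u * (Q * x) ^ ret1_plus n u *
        ((1 - Q * x) * geom p) ^ u 1) * geom q ^ (n + 1) =
      P * Q * x * ((P * x) ^ ret1_minus n u * (Q * x) ^ ret1_plus n u * geom p ^ u 1 *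
        geom q ^ (n + 1 - u 1))"
      unfolding split by (simp only: mult.assoc)
  qed
  finally show ?thesis using 1 unfolding div by simp
qed

end
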